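(* Let $\Gamma$ be a countable discrete group and let $\alpha$ be an expansive action of $\Gamma$ on a compact metrizable abelian group $X$ by automorphisms. Then the following are equivalent: (1) $\alpha$ has weak specification; (2) $\alpha$ has strong specification; (3) $\alpha$ has homoclinic specification. Furthermore, these conditions imply (4) $\Delta(X)$ is dense in $X$.
   Context: Let $\rho$ be a compatible metric on $X$. The action is expansive if there is $c>0$ with $\sup_{s\in\Gamma}\rho(sx,sy)>c$ for all distinct $x,y\in X$. $\Delta(X)$ is the set of homoclinic points: those $x\in X$ with $sx\to e_X$ as $\Gamma\ni s\to\infty$. Weak specification: for every $\varepsilon>0$ there is a nonempty finite $F\subseteq\Gamma$ such that for any finite collection $F_1,\dots,F_m$ of finite subsets of $\Gamma$ with (a) $FF_i\cap F_j=\emptyset$ for all $1\le i,j\le m$, $i\ne j$, and any points $x^{(1)},\dots,x^{(m)}\in X$, there exists $y\in X$ with (b) $\rho(sx^{(j)},sy)\le\varepsilon$ for all $s\in F_j$, $1\le j\le m$. Strong specification: for every $\varepsilon>0$ there is a nonempty finite $F\subseteq\Gamma$ such that for any finite collection $F_1,\dots,F_m$ of finite subsets of $\Gamma$ satisfying (a), any subgroup $\Gamma'$ of $\Gamma$ with $FF_i\cap F_j(\Gamma'\setminus\{e_\Gamma\})=\emptyset$ for all $1\le i,j\le m$, and any points $x^{(1)},\dots,x^{(m)}\in X$, there exists $y\in X$ satisfying (b) and $sy=y$ for all $s\in\Gamma'$. Homoclinic specification: for every $\varepsilon>0$ there is a nonempty finite $F\subseteq\Gamma$ such that for any finite $F_1\subseteq\Gamma$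 and any $x\in X$ there exists $y\in\Delta(X)$ with $\rho(sx,sy)\le\varepsilon$ for all $s\in F_1$ and $\rho(e_X,sy)\le\varepsilon$ for all $s\in\Gamma\setminus FF_1$. *)

theory Defs
  imports "HOL-Algebra.Group_Action" "HOL-Analysis.Analysis"
begin

text \<open>
  The group \<open>\<Gamma>\<close> is an \<open>HOL-Algebra\<close> group \<open>G\<close>, possibly non-abelian and
  written multiplicatively.  The group \<open>X\<close> is the whole of a type \<open>'x\<close> which is simultaneously a
  topological abelian group (written additively, so that \<open>e\<^sub>X = 0\<close>) and a metric space; the class
  \<^class>\<open>metric_space\<close> forces the topology to be the one induced by \<^const>\<open>dist\<close>, so \<^const>\<open>dist\<close>
  plays the role of the compatible metric \<open>\<rho>\<close>.  Compactness of \<open>X\<close> is the hypothesis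
  \<open>compact UNIV\<close>.
\<close>

text \<open>
  Each \<open>\<alpha> g\<close> is bijective because \<open>\<alpha>\<close> is a homomorphism into \<^term>\<open>BijGroup UNIV\<close>, and
  its inverse \<open>\<alpha> (inv g)\<close> is again additive and continuous.
\<close>

definition acts_by_automorphisms ::
    "('g, 'b) monoid_scheme \<Rightarrow> ('g \<Rightarrow> 'x :: {topological_ab_group_add, metric_space} \<Rightarrow> 'x) \<Rightarrow> bool"
  where "acts_by_automorphisms G \<alpha> \<longleftrightarrow>
    group_action G UNIV \<alpha> \<and>
    (\<forall>s\<in>carrier G. (\<forall>x y. \<alpha> s (x + y) = \<alpha> s x + \<alpha> s y) \<and> continuous_on UNIV (\<alpha> s))"

text \<open>For compact \<open>X\<close> the real supremum is taken over a bounded nonempty set.\<close>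

definition expansive ::
    "('g, 'b) monoid_scheme \<Rightarrow> ('g \<Rightarrow> 'x :: metric_space \<Rightarrow> 'x) \<Rightarrow> bool"
  where "expansive G \<alpha> \<longleftrightarrow>
    (\<exists>c>0. \<forall>x y. x \<noteq> y \<longrightarrow> (SUP s\<in>carrier G. dist (\<alpha> s x) (\<alpha> s y)) > c)"

text \<open>
  The filter expresses \<open>\<Gamma> \<ni> s \<rightarrow> \<infinity>\<close> for discrete \<open>\<Gamma>\<close>; it is trivial when \<open>\<Gamma>\<close> is finite,
  in which case every point is homoclinic.
\<close>

definition homoclinic_points ::
    "('g, 'b) monoid_scheme \<Rightarrow> ('g \<Rightarrow> 'x :: {topological_ab_group_add, metric_space} \<Rightarrow> 'x) \<Rightarrow> 'x set"
  where "homoclinic_points G \<alpha> =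
    {x. ((\<lambda>s. \<alpha> s x) \<longlongrightarrow> 0) (inf cofinite (principal (carrier G)))}"

definition weak_specification ::
    "('g, 'b) monoid_scheme \<Rightarrow> ('g \<Rightarrow> 'x :: metric_space \<Rightarrow> 'x) \<Rightarrow> bool"
  where "weak_specification G \<alpha> \<longleftrightarrow>
    (\<forall>\<epsilon>>0. \<exists>F. finite F \<and> F \<noteq> {} \<and> F \<subseteq> carrier G \<and>
      (\<forall>(m::nat) (Fs :: nat \<Rightarrow> 'g set) (xs :: nat \<Rightarrow> 'x).
        (\<forall>j\<in>{1..m}. finite (Fs j) \<and> Fs j \<subseteq> carrier G) \<longrightarrow>
        (\<forall>i\<in>{1..m}. \<forall>j\<in>{1..m}. i \<noteq> j \<longrightarrow> (F <#>\<^bsub>G\<^esub> Fs i) \<inter> Fs j = {}) \<longrightarrow>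
        (\<exists>y. \<forall>j\<in>{1..m}. \<forall>s\<in>Fs j. dist (\<alpha> s (xs j)) (\<alpha> s y) \<le> \<epsilon>)))"

definition strong_specification ::
    "('g, 'b) monoid_scheme \<Rightarrow> ('g \<Rightarrow> 'x :: metric_space \<Rightarrow> 'x) \<Rightarrow> bool"
  where "strong_specification G \<alpha> \<longleftrightarrow>
    (\<forall>\<epsilon>>0. \<exists>F. finite F \<and> F \<noteq> {} \<and> F \<subseteq> carrier G \<and>
      (\<forall>(m::nat) (Fs :: nat \<Rightarrow> 'g set) (H :: 'g set) (xs :: nat \<Rightarrow> 'x).
        (\<forall>j\<in>{1..m}. finite (Fs j) \<and> Fs j \<subseteq> carrier G) \<longrightarrow>
        (\<forall>i\<in>{1..m}. \<forall>j\<in>{1..m}. i \<noteq> j \<longrightarrow> (F <#>\<^bsub>G\<^esub> Fs i) \<inter> Fs j = {}) \<longrightarrow>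
        subgroup H G \<longrightarrow>
        (\<forall>i\<in>{1..m}. \<forall>j\<in>{1..m}.
          (F <#>\<^bsub>G\<^esub> Fs i) \<inter> (Fs j <#>\<^bsub>G\<^esub> (H - {\<one>\<^bsub>G\<^esub>})) = {}) \<longrightarrow>
        (\<exists>y. (\<forall>j\<in>{1..m}. \<forall>s\<in>Fs j. dist (\<alpha> s (xs j)) (\<alpha> s y) \<le> \<epsilon>) \<and>
             (\<forall>s\<in>H. \<alpha> s y = y))))"

definition homoclinic_specification ::
    "('g, 'b) monoid_scheme \<Rightarrow> ('g \<Rightarrow> 'x :: {topological_ab_group_add, metric_space} \<Rightarrow> 'x) \<Rightarrow> bool"
  where "homoclinic_specification G \<alpha> \<longleftrightarrow>
    (\<forall>\<epsilon>>0. \<exists>F. finite F \<and> F \<noteq> {} \<and> F \<subseteq> carrier G \<and>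
      (\<forall>F1 x. finite F1 \<longrightarrow> F1 \<subseteq> carrier G \<longrightarrow>
        (\<exists>y\<in>homoclinic_points G \<alpha>.
          (\<forall>s\<in>F1. dist (\<alpha> s x) (\<alpha> s y) \<le> \<epsilon>) \<and>
          (\<forall>s\<in>carrier G - (F <#>\<^bsub>G\<^esub> F1). dist 0 (\<alpha> s y) \<le> \<epsilon>))))"

end

theory Submission
  imports Defs
begin

text \<open>
  Write \<open>|x|\<close> for the distance of \<open>x\<close> from \<open>0\<close>.  Expansiveness gives \<open>c > 0\<close> such that \<open>|s x| \<le> c\<close>
  for all \<open>s\<close> forces \<open>x = 0\<close>, and by compactness, for each \<open>\<delta> > 0\<close>, already \<open>|s x| \<le> c\<close> for all \<open>s\<close>
  in a finite set \<open>E\<close> forces \<open>|x| < \<delta>\<close>.  Hence a point whose orbit is \<open>c\<close>-small off a finite set is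
  homoclinic, and weak specification together with compactness produces such points.

  For the passage from homoclinic to strong specification no summable decay of homoclinic points is
  needed.  If \<open>|t y\<^sub>i| \<le> \<delta>\<close> off \<open>A\<^sub>i\<close> and the thickened supports \<open>E\<inverse> A\<^sub>i\<close> are pairwise disjoint, then
  \<open>\<Sum> y\<^sub>i\<close> is \<open>\<delta>\<close>-small off \<open>\<Union> E\<inverse> A\<^sub>i\<close>, however many summands there are: the bound \<open>c\<close> off
  \<open>\<Union> A\<^sub>i\<close> improves itself to \<open>\<delta>\<close> by the choice of \<open>E\<close>.  Applied to the translates \<open>k\<inverse> y\<^sub>j\<close>,
  \<open>k \<in> \<Gamma>'\<close>, of homoclinic points \<open>y\<^sub>j\<close> shadowing \<open>x\<^sup>(\<^sup>j\<^sup>)\<close> on \<open>F\<^sub>j\<close>, this shows that any cluster point of the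
  finite partial sums of the formal \<open>\<Gamma>'\<close>-invariant sum is as required.
\<close>

section \<open>Preliminaries on sums and translations\<close>

lemma sum_diff_sum:
  fixes f :: "'i \<Rightarrow> 'a::ab_group_add"
  assumes "finite P" "finite Q"
  shows "sum f P - sum f Q = sum f (P - Q) - sum f (Q - P)"
proof -
  have "sum f P = sum f (P - Q) + sum f (P \<inter> Q)"
    by (metis add.commute assms(1) sum.Int_Diff)
  moreover have "sum f Q = sum f (Q - P) + sum f (P \<inter> Q)"
    by (metis add.commute assms(2) Int_commute sum.Int_Diff)
  ultimately show ?thesis by simp
qed

text \<open>The metric may fail to be translation invariant, so smallness of \<open>u\<close> has to
  be turned into closeness of \<open>a\<close> to \<open>a + u\<close> and \<open>a - u\<close>,
  uniformly in \<open>a\<close>. This is uniform continuity of addition and subtraction on the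
  compact space of pairs.\<close>

lemma uniformly_small_translation:
  assumes "compact (UNIV :: 'x::{topological_ab_group_add, metric_space} set)" and "\<eta> > 0"
  obtains \<delta> where "\<delta> > 0"
    and "\<And>a u :: 'x. dist 0 u \<le> \<delta> \<Longrightarrow> dist a (a + u) \<le> \<eta>"
    and "\<And>a u :: 'x. dist 0 u \<le> \<delta> \<Longrightarrow> dist a (a - u) \<le> \<eta>"
proof -
  have cpt: "compact (UNIV :: ('x \<times> 'x) set)"
    using compact_Times[OF assms(1) assms(1)] by simp
  have unif: "\<exists>d>0. \<forall>a u. dist 0 u < d \<longrightarrow> dist (f (a, 0)) (f (a, u)) < \<eta>"
    if "continuous_on UNIV f" for f :: "'x \<times> 'x \<Rightarrow> 'x"
  proof -
    have "uniformly_continuous_on UNIV f"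
      using that cpt by (rule compact_uniformly_continuous)
    then obtain d where d: "d > 0" "\<And>p q. dist q p < d \<Longrightarrow> dist (f q) (f p) < \<eta>"
      unfolding uniformly_continuous_on_def using \<open>\<eta> > 0\<close> by blast
    have "dist (f (a, 0)) (f (a, u)) < \<eta>" if "dist 0 u < d" for a u
      using that by (intro d(2)) (simp add: dist_Pair_Pair)
    with d(1) show ?thesis by blast
  qed
  have "continuous_on UNIV (\<lambda>p :: 'x \<times> 'x. fst p + snd p)"
    by (intro continuous_intros)
  from unif[OF this] obtain d1 where d1: "d1 > 0" "\<And>a u :: 'x. dist 0 u < d1 \<Longrightarrow> dist a (a + u) < \<eta>"
    by auto
  have "continuous_on UNIV (\<lambda>p :: 'x \<times> 'x. fst p - snd p)"
    by (intro continuous_intros)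
  from unif[OF this] obtain d2 where d2: "d2 > 0" "\<And>a u :: 'x. dist 0 u < d2 \<Longrightarrow> dist a (a - u) < \<eta>"
    by auto
  \<comment> \<open>Halving makes the non-strict bound \<open>dist 0 u \<le> \<delta>\<close> imply
    both strict ones.\<close>
  define \<delta> where "\<delta> = min d1 d2 / 2"
  have "\<delta> > 0" "\<delta> < d1" "\<delta> < d2"
    using d1(1) d2(1) by (auto simp: \<delta>_def min_def)
  then show ?thesis
    using that[of \<delta>] d1(2) d2(2) by (meson le_less_trans less_imp_le)
qed

section \<open>From strong to weak specification\<close>

text \<open>For the trivial subgroup, \<open>H - {\<one>}\<close> is empty, so the extra
  disjointness condition is vacuous and the same \<open>F\<close> serves.\<close>

lemma strong_imp_weak_specification:
  assumes "group G" and "strong_specification G \<alpha>"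
  shows "weak_specification G \<alpha>"
  unfolding weak_specification_def
proof (intro allI impI)
  fix \<epsilon> :: real
  assume "\<epsilon> > 0"
  interpret group G by fact
  obtain F where F: "finite F" "F \<noteq> {}" "F \<subseteq> carrier G"
    and spec: "\<And>(m::nat) Fs H xs.
      \<lbrakk>\<forall>j\<in>{1..m}. finite (Fs j) \<and> Fs j \<subseteq> carrier G;
       \<forall>i\<in>{1..m}. \<forall>j\<in>{1..m}. i \<noteq> j \<longrightarrow> (F <#>\<^bsub>G\<^esub> Fs i) \<inter> Fs j = {};
       subgroup H G;
       \<forall>i\<in>{1..m}. \<forall>j\<in>{1..m}. (F <#>\<^bsub>G\<^esub> Fs i) \<inter> (Fs j <#>\<^bsub>G\<^esub> (H - {\<one>\<^bsub>G\<^esub>})) = {}\<rbrakk> \<Longrightarrow>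
      \<exists>y. (\<forall>j\<in>{1..m}. \<forall>s\<in>Fs j. dist (\<alpha> s (xs j)) (\<alpha> s y) \<le> \<epsilon>) \<and> (\<forall>s\<in>H. \<alpha> s y = y)"
    using assms(2) \<open>\<epsilon> > 0\<close> unfolding strong_specification_def by (smt (verit))
  have "\<exists>y. \<forall>j\<in>{1..m}. \<forall>s\<in>Fs j. dist (\<alpha> s (xs j)) (\<alpha> s y) \<le> \<epsilon>"
    if "\<forall>j\<in>{1..m}. finite (Fs j) \<and> Fs j \<subseteq> carrier G"
      and "\<forall>i\<in>{1..m}. \<forall>j\<in>{1..m}. i \<noteq> j \<longrightarrow> (F <#>\<^bsub>G\<^esub> Fs i) \<inter> Fs j = {}"
    for m :: nat and Fs xs
    using spec[OF that triv_subgroup, of xs] by (auto simp: set_mult_def)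
  with F show "\<exists>F. finite F \<and> F \<noteq> {} \<and> F \<subseteq> carrier G \<and>
      (\<forall>(m::nat) Fs xs.
        (\<forall>j\<in>{1..m}. finite (Fs j) \<and> Fs j \<subseteq> carrier G) \<longrightarrow>
        (\<forall>i\<in>{1..m}. \<forall>j\<in>{1..m}. i \<noteq> j \<longrightarrow> (F <#>\<^bsub>G\<^esub> Fs i) \<inter> Fs j = {}) \<longrightarrow>
        (\<exists>y. \<forall>j\<in>{1..m}. \<forall>s\<in>Fs j. dist (\<alpha> s (xs j)) (\<alpha> s y) \<le> \<epsilon>))"
    by blast
qed

section \<open>Expansive actions and localization to finite sets\<close>

text \<open>The supremum in \<open>expansive\<close> becomes a witness \<open>s\<close>, and points
  are compared with \<open>0\<close> only: two points are shown equal by testing their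
  difference.\<close>

locale expansive_algebraic_action = group G
  for G :: "('g, 'b) monoid_scheme" (structure) +
  fixes \<alpha> :: "'g \<Rightarrow> 'x :: {topological_ab_group_add, metric_space} \<Rightarrow> 'x"
    and c :: real
  assumes compact_space: "compact (UNIV :: 'x set)"
    and acts: "acts_by_automorphisms G \<alpha>"
    and c_pos: "c > 0"
    and expansive_at_zero: "x \<noteq> 0 \<Longrightarrow> \<exists>s\<in>carrier G. dist 0 (\<alpha> s x) > c"
begin

lemma act_add: "s \<in> carrier G \<Longrightarrow> \<alpha> s (x + y) = \<alpha> s x + \<alpha> s y"
  and continuous_act: "s \<in> carrier G \<Longrightarrow> continuous_on UNIV (\<alpha> s)"
  using acts by (auto simp: acts_by_automorphisms_def)

lemma act_mult: "s \<in> carrier G \<Longrightarrow> t \<in> carrier G \<Longrightarrow> \<alpha> (s \<otimes> t) x = \<alpha> s (\<alpha> t x)"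
  using acts group_action.composition_rule[of G UNIV \<alpha> x s t]
  by (auto simp: acts_by_automorphisms_def)

lemma act_one: "\<alpha> \<one> x = x"
  using acts group_action.id_eq_one[of G UNIV \<alpha>]
  by (auto simp: acts_by_automorphisms_def fun_eq_iff dest: fun_cong)

lemma act_zero: "s \<in> carrier G \<Longrightarrow> \<alpha> s 0 = 0"
  using act_add[of s 0 0] by simp

lemma act_diff: "s \<in> carrier G \<Longrightarrow> \<alpha> s (x - y) = \<alpha> s x - \<alpha> s y"
  using act_add[of s "x - y" y] by (simp add: algebra_simps)

lemma act_sum: "s \<in> carrier G \<Longrightarrow> \<alpha> s (\<Sum>i\<in>I. f i) = (\<Sum>i\<in>I. \<alpha> s (f i))"
  by (induction I rule: infinite_finite_induct) (auto simp: act_zero act_add)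

lemma continuous_act_comp [continuous_intros]:
  "s \<in> carrier G \<Longrightarrow> continuous_on S f \<Longrightarrow> continuous_on S (\<lambda>x. \<alpha> s (f x))"
  using continuous_on_compose2[OF continuous_act] by blast

lemma eq_zero_if_orbit_small:
  assumes "\<And>s. s \<in> carrier G \<Longrightarrow> dist 0 (\<alpha> s x) \<le> c"
  shows "x = 0"
  using assms expansive_at_zero[of x] by force

text \<open>If every finite \<open>E\<close> failed, the closed sets \<open>C s\<close> would have
  the finite intersection property. By compactness some point at distance at least
  \<open>\<delta>\<close> from \<open>0\<close> would have its whole orbit within \<open>c\<close>
  of \<open>0\<close>, against expansiveness.\<close>

lemma expansive_localize:
  assumes "\<delta> > 0"
  obtains E where "finite E" "E \<subseteq> carrier G" "\<one> \<in> E"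
    and "\<And>x. (\<And>s. s \<in> E \<Longrightarrow> dist 0 (\<alpha> s x) \<le> c) \<Longrightarrow> dist 0 x < \<delta>"
proof (rule ccontr)
  assume neg: "\<not> thesis"
  define C where "C s = {x. dist 0 (\<alpha> s x) \<le> c \<and> \<delta> \<le> dist 0 x}" for s
  have "UNIV \<inter> (\<Inter>s\<in>carrier G. C s) \<noteq> {}"
  proof (rule compact_imp_fip_image[OF compact_space])
    show "closed (C s)" if "s \<in> carrier G" for s
      unfolding C_def using that
      by (intro closed_Collect_conj closed_Collect_le continuous_intros) auto
  next
    fix E assume E: "finite E" "E \<subseteq> carrier G"
    have "\<exists>x. (\<forall>s\<in>insert \<one> E. dist 0 (\<alpha> s x) \<le> c) \<and> \<not> dist 0 x < \<delta>"
      using that[of "insert \<one> E"] E neg by auto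
    then show "UNIV \<inter> (\<Inter>s\<in>E. C s) \<noteq> {}"
      by (auto simp: C_def)
  qed
  then obtain x where x: "\<And>s. s \<in> carrier G \<Longrightarrow> dist 0 (\<alpha> s x) \<le> c \<and> \<delta> \<le> dist 0 x"
    by (auto simp: C_def)
  then have "x = 0"
    by (intro eq_zero_if_orbit_small) blast
  with x[of \<one>] \<open>\<delta> > 0\<close> show False
    by simp
qed

text \<open>Off the finite set of all \<open>inv s \<otimes> b\<close> with
  \<open>s \<in> E\<close>, \<open>b \<in> B\<close>, every product \<open>s \<otimes> t\<close>
  avoids \<open>B\<close>, so localization applies to the point \<open>\<alpha> t y\<close>.\<close>

lemma homoclinic_if_small_off_finite:
  assumes "finite B" and "B \<subseteq> carrier G"
    and small: "\<And>s. s \<in> carrier G - B \<Longrightarrow> dist 0 (\<alpha> s y) \<le> c"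
  shows "y \<in> homoclinic_points G \<alpha>"
proof -
  have "\<forall>\<^sub>F s in inf cofinite (principal (carrier G)). dist (\<alpha> s y) 0 < \<delta>" if \<delta>: "\<delta> > 0" for \<delta>
  proof -
    obtain E where E: "finite E" "E \<subseteq> carrier G"
      and loc: "\<And>x. (\<And>s. s \<in> E \<Longrightarrow> dist 0 (\<alpha> s x) \<le> c) \<Longrightarrow> dist 0 x < \<delta>"
      using expansive_localize[OF \<delta>] by metis
    have "dist 0 (\<alpha> t y) < \<delta>"
      if t: "t \<in> carrier G" "t \<notin> (\<lambda>(s, b). inv s \<otimes> b) ` (E \<times> B)" for t
    proof (rule loc)
      fix s assume s: "s \<in> E"
      with E have sG: "s \<in> carrier G" by blast
      have "s \<otimes> t \<notin> B"
      proof
        assume "s \<otimes> t \<in> B"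
        moreover have "t = inv s \<otimes> (s \<otimes> t)"
          using sG t(1) by (simp add: m_assoc[symmetric])
        ultimately show False using s t(2) by force
      qed
      then show "dist 0 (\<alpha> s (\<alpha> t y)) \<le> c"
        using small[of "s \<otimes> t"] sG t(1) by (simp add: act_mult)
    qed
    then have "{t. \<not> (t \<in> carrier G \<longrightarrow> dist (\<alpha> t y) 0 < \<delta>)} \<subseteq> (\<lambda>(s, b). inv s \<otimes> b) ` (E \<times> B)"
      by (auto simp: dist_commute)
    then have "finite {t. \<not> (t \<in> carrier G \<longrightarrow> dist (\<alpha> t y) 0 < \<delta>)}"
      by (rule finite_subset) (use E assms(1) in auto)
    then show ?thesis
      unfolding eventually_inf_principal eventually_cofinite by simp
  qed
  then show ?thesis
    unfolding homoclinic_points_def by (auto intro: tendstoI)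
qed

section \<open>From weak to homoclinic specification\<close>

text \<open>Two sets are enough: shadow \<open>x\<close> on \<open>F1\<close> and \<open>0\<close>
  on a finite piece of the complement of \<open>F' <#> F1\<close>. Compactness replaces the finite
  pieces by the whole complement.\<close>

lemma weak_imp_homoclinic_specification:
  assumes "weak_specification G \<alpha>"
  shows "homoclinic_specification G \<alpha>"
  unfolding homoclinic_specification_def
proof (intro allI impI)
  fix \<epsilon> :: real
  assume "\<epsilon> > 0"
  \<comment> \<open>The bound \<open>c\<close> is what makes the limit point homoclinic, by
    \<open>homoclinic_if_small_off_finite\<close>.\<close>
  define \<epsilon>' where "\<epsilon>' = min \<epsilon> c"
  have "\<epsilon>' > 0" "\<epsilon>' \<le> \<epsilon>" "\<epsilon>' \<le> c"
    using \<open>\<epsilon> > 0\<close> c_pos by (auto simp: \<epsilon>'_def)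
  obtain F where F: "finite F" "F \<noteq> {}" "F \<subseteq> carrier G"
    and spec: "\<And>(m::nat) Fs xs.
      \<lbrakk>\<forall>j\<in>{1..m}. finite (Fs j) \<and> Fs j \<subseteq> carrier G;
       \<forall>i\<in>{1..m}. \<forall>j\<in>{1..m}. i \<noteq> j \<longrightarrow> (F <#> Fs i) \<inter> Fs j = {}\<rbrakk> \<Longrightarrow>
      \<exists>y. (\<forall>j\<in>{1..m}. \<forall>s\<in>Fs j. dist (\<alpha> s (xs j)) (\<alpha> s y) \<le> \<epsilon>')"
    using assms \<open>\<epsilon>' > 0\<close> unfolding weak_specification_def by (smt (verit))
  \<comment> \<open>The two sets must be disjoint with \<open>F\<close> applied to either one; the
    inverses take care of \<open>F\<close> acting on the complementary piece.\<close>
  define F' where "F' = F \<union> m_inv G ` F"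
  have F': "finite F'" "F' \<noteq> {}" "F' \<subseteq> carrier G"
    using F by (auto simp: F'_def)
  have "\<exists>y\<in>homoclinic_points G \<alpha>. (\<forall>s\<in>F1. dist (\<alpha> s x) (\<alpha> s y) \<le> \<epsilon>) \<and>
      (\<forall>s\<in>carrier G - (F' <#> F1). dist 0 (\<alpha> s y) \<le> \<epsilon>)"
    if F1: "finite F1" "F1 \<subseteq> carrier G" for F1 x
  proof -
    define C where "C s = {y. (s \<in> F1 \<longrightarrow> dist (\<alpha> s x) (\<alpha> s y) \<le> \<epsilon>') \<and>
      (s \<notin> F' <#> F1 \<longrightarrow> dist 0 (\<alpha> s y) \<le> \<epsilon>')}" for s
    have "UNIV \<inter> (\<Inter>s\<in>carrier G. C s) \<noteq> {}"
    proof (rule compact_imp_fip_image[OF compact_space])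
      show "closed (C s)" if "s \<in> carrier G" for s
        unfolding C_def using that
        by (intro closed_Collect_conj closed_Collect_imp closed_Collect_le continuous_intros) auto
    next
      fix S assume S: "finite S" "S \<subseteq> carrier G"
      define Fs where "Fs j = (if j = 1 then F1 else S - (F' <#> F1))" for j :: nat
      define xs where "xs j = (if j = 1 then x else 0)" for j :: nat
      have sub: "Fs j \<subseteq> carrier G" for j
        using S F1 by (auto simp: Fs_def)
      have "(F <#> F1) \<inter> (S - (F' <#> F1)) = {}"
        by (auto simp: F'_def set_mult_def)
      moreover have "(F <#> (S - (F' <#> F1))) \<inter> F1 = {}"
      proof (intro equalityI subsetI; (elim IntE)?)
        fix t assume t: "t \<in> F <#> (S - (F' <#> F1))" "t \<in> F1"
        then obtain f s where fs: "f \<in> F" "s \<in> S" "s \<notin> F' <#> F1" "t = f \<otimes> s"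
          by (auto simp: set_mult_def)
        then have "s = inv f \<otimes> t"
          using F S by (auto simp: m_assoc[symmetric] subset_iff)
        then have "s \<in> F' <#> F1"
          using fs(1) t(2) by (auto simp: F'_def set_mult_def)
        with fs show "t \<in> {}" by blast
      qed simp
      ultimately have disj: "\<forall>i\<in>{1..2}. \<forall>j\<in>{1..2}. i \<noteq> j \<longrightarrow> (F <#> Fs i) \<inter> Fs j = {}"
        by (auto simp: Fs_def)
      have fin: "\<forall>j\<in>{1..2}. finite (Fs j) \<and> Fs j \<subseteq> carrier G"
        using sub F1 S by (simp add: Fs_def)
      obtain y where y: "\<And>j s. j \<in> {1..2} \<Longrightarrow> s \<in> Fs j \<Longrightarrow> dist (\<alpha> s (xs j)) (\<alpha> s y) \<le> \<epsilon>'"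
        using spec[OF fin disj, of xs] by blast
      have "y \<in> C s" if "s \<in> S" for s
        using y[of 1 s] y[of 2 s] that S by (auto simp: C_def Fs_def xs_def act_zero subset_iff)
      then show "UNIV \<inter> (\<Inter>s\<in>S. C s) \<noteq> {}" by blast
    qed
    then obtain y where y: "\<And>s. s \<in> carrier G \<Longrightarrow> y \<in> C s" by blast
    have "y \<in> homoclinic_points G \<alpha>"
    proof (rule homoclinic_if_small_off_finite)
      show "finite (F' <#> F1)"
        using F' F1 by (auto simp: set_mult_def)
      show "F' <#> F1 \<subseteq> carrier G"
        using F' F1 by (intro set_mult_closed)
      show "dist 0 (\<alpha> s y) \<le> c" if "s \<in> carrier G - (F' <#> F1)" for s
        using y[of s] that \<open>\<epsilon>' \<le> c\<close> by (auto simp: C_def)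
    qed
    moreover have "\<forall>s\<in>F1. dist (\<alpha> s x) (\<alpha> s y) \<le> \<epsilon>"
      using y F1 \<open>\<epsilon>' \<le> \<epsilon>\<close> by (force simp: C_def)
    moreover have "\<forall>s\<in>carrier G - (F' <#> F1). dist 0 (\<alpha> s y) \<le> \<epsilon>"
      using y \<open>\<epsilon>' \<le> \<epsilon>\<close> by (force simp: C_def)
    ultimately show ?thesis by blast
  qed
  with F' show "\<exists>F. finite F \<and> F \<noteq> {} \<and> F \<subseteq> carrier G \<and>
      (\<forall>F1 x. finite F1 \<longrightarrow> F1 \<subseteq> carrier G \<longrightarrow>
        (\<exists>y\<in>homoclinic_points G \<alpha>. (\<forall>s\<in>F1. dist (\<alpha> s x) (\<alpha> s y) \<le> \<epsilon>) \<and>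
          (\<forall>s\<in>carrier G - (F <#> F1). dist 0 (\<alpha> s y) \<le> \<epsilon>)))"
    by blast
qed

section \<open>Density of homoclinic points\<close>

lemma homoclinic_specification_imp_dense:
  assumes "homoclinic_specification G \<alpha>"
  shows "closure (homoclinic_points G \<alpha>) = UNIV"
proof -
  have "\<exists>y\<in>homoclinic_points G \<alpha>. dist y x < \<epsilon>" if "\<epsilon> > 0" for x \<epsilon>
  proof -
    \<comment> \<open>Shadowing at \<open>\<one>\<close> alone gives approximation; the half
      provides the strict inequality in \<open>closure_approachable\<close>.\<close>
    have "\<epsilon> / 2 > 0" using that by simp
    then obtain F where "\<And>F1 x. finite F1 \<Longrightarrow> F1 \<subseteq> carrier G \<Longrightarrow>
        \<exists>y\<in>homoclinic_points G \<alpha>. \<forall>s\<in>F1. dist (\<alpha> s x) (\<alpha> s y) \<le> \<epsilon> / 2"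
      using assms unfolding homoclinic_specification_def by meson
    from this[of "{\<one>}" x] obtain y
      where "y \<in> homoclinic_points G \<alpha>" "dist x y \<le> \<epsilon> / 2"
      by (auto simp: act_one)
    with that show ?thesis
      by (intro bexI[of _ y]) (auto simp: dist_commute)
  qed
  then show ?thesis
    by (auto simp: closure_approachable)
qed

section \<open>Sums of points with separated supports\<close>

text \<open>The thickened support of \<open>i\<close> consists of the \<open>t\<close> with
  \<open>s \<otimes> t \<in> A i\<close> for some \<open>s \<in> E\<close>; \<open>separated\<close>
  makes these disjoint. \<open>add\<close> stands in for the triangle inequality of an invariant
  metric.\<close>

lemma sum_small_off_supports:
  assumes E: "E \<subseteq> carrier G" "\<one> \<in> E"
    and loc: "\<And>x. (\<And>s. s \<in> E \<Longrightarrow> dist 0 (\<alpha> s x) \<le> c) \<Longrightarrow> dist 0 x \<le> \<delta>"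
    and add: "\<And>u v :: 'x. dist 0 u \<le> \<delta> \<Longrightarrow> dist 0 v \<le> \<delta> \<Longrightarrow> dist 0 (u + v) \<le> c"
    and "finite I"
    and small: "\<And>i t. i \<in> I \<Longrightarrow> t \<in> carrier G \<Longrightarrow> t \<notin> A i \<Longrightarrow> dist 0 (\<alpha> t (y i)) \<le> \<delta>"
    and separated: "\<And>i j t s s'. \<lbrakk>i \<in> I; j \<in> I; t \<in> carrier G; s \<in> E; s' \<in> E;
      s \<otimes> t \<in> A i; s' \<otimes> t \<in> A j\<rbrakk> \<Longrightarrow> i = j"
    and t: "t \<in> carrier G" "\<And>i s. i \<in> I \<Longrightarrow> s \<in> E \<Longrightarrow> s \<otimes> t \<notin> A i"
  shows "dist 0 (\<alpha> t (\<Sum>i\<in>I. y i)) \<le> \<delta>"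
proof -
  \<comment> \<open>To get \<open>\<delta>\<close> at \<open>t\<close>, \<open>loc\<close> asks only
    for the bound \<open>c\<close> at the products \<open>s \<otimes> t\<close>, all of which lie
    off the sets \<open>A i\<close>.\<close>
  have bootstrap: "dist 0 (\<alpha> t (\<Sum>i\<in>J. y i)) \<le> \<delta>"
    if coarse: "\<And>t. t \<in> carrier G \<Longrightarrow> (\<And>i. i \<in> J \<Longrightarrow> t \<notin> A i) \<Longrightarrow> dist 0 (\<alpha> t (\<Sum>i\<in>J. y i)) \<le> c"
      and t: "t \<in> carrier G" "\<And>i s. i \<in> J \<Longrightarrow> s \<in> E \<Longrightarrow> s \<otimes> t \<notin> A i"
    for J t
  proof (rule loc)
    fix s assume "s \<in> E"
    with coarse[of "s \<otimes> t"] t E(1) show "dist 0 (\<alpha> s (\<alpha> t (\<Sum>i\<in>J. y i))) \<le> c"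
      by (simp add: act_mult subset_iff)
  qed
  have coarse: "dist 0 (\<alpha> t (\<Sum>i\<in>J. y i)) \<le> c"
    if "finite J" "J \<subseteq> I" "t \<in> carrier G" "\<And>i. i \<in> J \<Longrightarrow> t \<notin> A i" for J t
    using that
  \<comment> \<open>\<open>t\<close> is generalized because \<open>bootstrap\<close> evaluates the
    shorter sum at other group elements.\<close>
  proof (induction "card J" arbitrary: J t)
    case 0
    then show ?case using c_pos by (simp add: act_zero)
  next
    case (Suc n)
    \<comment> \<open>Split off the summand whose thickened support contains \<open>t\<close>, if there is one; the rest is
      then even \<open>\<delta>\<close>-small at \<open>t\<close>, so the bound does not deteriorate with the number of summands.\<close>
    obtain k where k: "k \<in> J" "\<And>i s. i \<in> J - {k} \<Longrightarrow> s \<in> E \<Longrightarrow> s \<otimes> t \<notin> A i"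
    proof (cases "\<exists>k\<in>J. \<exists>s\<in>E. s \<otimes> t \<in> A k")
      case True
      then obtain k s where ks: "k \<in> J" "s \<in> E" "s \<otimes> t \<in> A k" by blast
      show ?thesis
      proof (rule that[of k])
        show "s' \<otimes> t \<notin> A i" if "i \<in> J - {k}" "s' \<in> E" for i s'
          using separated[of i k t s' s] ks that Suc.prems by auto
      qed (fact ks(1))
    next
      case False
      moreover obtain k where "k \<in> J"
        using Suc.hyps(2) by fastforce
      ultimately show ?thesis using that[of k] by blast
    qed
    \<comment> \<open>The induction hypothesis bounds the shorter sum by \<open>c\<close>,
      \<open>bootstrap\<close> sharpens this to \<open>\<delta>\<close> at \<open>t\<close>, and
      \<open>add\<close> returns \<open>c\<close> for the full sum.\<close>
    have "dist 0 (\<alpha> t (\<Sum>i\<in>J - {k}. y i)) \<le> \<delta>"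
    proof (rule bootstrap)
      show "dist 0 (\<alpha> t' (\<Sum>i\<in>J - {k}. y i)) \<le> c"
        if "t' \<in> carrier G" "\<And>i. i \<in> J - {k} \<Longrightarrow> t' \<notin> A i" for t'
        by (rule Suc.hyps(1)) (use Suc k that in auto)
    qed (use Suc k in auto)
    moreover have "dist 0 (\<alpha> t (y k)) \<le> \<delta>"
      using Suc.prems k(1) by (intro small) auto
    moreover have "(\<Sum>i\<in>J. y i) = y k + (\<Sum>i\<in>J - {k}. y i)"
      using Suc.prems(1) k(1) by (rule sum.remove)
    ultimately show ?case
      using add Suc.prems(3) by (simp add: act_add)
  qed
  show ?thesis
    using coarse[OF \<open>finite I\<close> order_refl] t by (intro bootstrap) auto
qed

section \<open>From homoclinic to strong specification\<close>

lemma homoclinic_imp_strong_specification: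
  assumes "homoclinic_specification G \<alpha>"
  shows "strong_specification G \<alpha>"
  unfolding strong_specification_def
proof (intro allI impI)
  fix \<epsilon> :: real
  assume "\<epsilon> > 0"
  \<comment> \<open>\<open>\<epsilon> / 2\<close> covers each leg of the path from
    \<open>xs j\<close> via \<open>y j\<close> to \<open>z\<close>; \<open>c / 2\<close> keeps sums
    and differences of two \<delta>-small points within \<open>c\<close>.\<close>
  define \<eta> where "\<eta> = min (\<epsilon> / 2) (c / 2)"
  have \<eta>: "\<eta> > 0" "\<eta> \<le> \<epsilon> / 2" "\<eta> \<le> c / 2"
    using \<open>\<epsilon> > 0\<close> c_pos by (auto simp: \<eta>_def)
  obtain d where "d > 0"
    and d_add: "\<And>a u :: 'x. dist 0 u \<le> d \<Longrightarrow> dist a (a + u) \<le> \<eta>"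
    and d_diff: "\<And>a u :: 'x. dist 0 u \<le> d \<Longrightarrow> dist a (a - u) \<le> \<eta>"
    using uniformly_small_translation[OF compact_space \<eta>(1)] by metis
  define \<delta> where "\<delta> = min d \<eta>"
  have \<delta>: "\<delta> > 0" "\<delta> \<le> d" "\<delta> \<le> \<eta>"
    using \<open>d > 0\<close> \<eta> by (auto simp: \<delta>_def)
  have add: "dist 0 (u + v) \<le> c" and diff: "dist 0 (u - v) \<le> c"
    if "dist 0 u \<le> \<delta>" "dist 0 v \<le> \<delta>" for u v :: 'x
    using that d_add[of v u] d_diff[of v u] \<delta> \<eta> dist_triangle[of 0 "u + v" u]
      dist_triangle[of 0 "u - v" u] by linarith+
  obtain E where E: "finite E" "E \<subseteq> carrier G" "\<one> \<in> E"
    and loc: "\<And>x. (\<And>s. s \<in> E \<Longrightarrow> dist 0 (\<alpha> s x) \<le> c) \<Longrightarrow> dist 0 x < \<delta>"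
    using expansive_localize[OF \<delta>(1)] by metis
  obtain F0 where F0: "finite F0" "F0 \<subseteq> carrier G"
    and spec: "\<And>F1 x. finite F1 \<Longrightarrow> F1 \<subseteq> carrier G \<Longrightarrow>
      \<exists>y\<in>homoclinic_points G \<alpha>. (\<forall>s\<in>F1. dist (\<alpha> s x) (\<alpha> s y) \<le> \<delta>) \<and>
        (\<forall>s\<in>carrier G - (F0 <#> F1). dist 0 (\<alpha> s y) \<le> \<delta>)"
    using assms \<delta>(1) unfolding homoclinic_specification_def by metis
  \<comment> \<open>With \<open>\<one>\<close> included, \<open>Fs j\<close> lies inside the support
    \<open>F <#> Fs j\<close>.\<close>
  define F where "F = insert \<one> F0"
  have F: "finite F" "F \<subseteq> carrier G" "\<one> \<in> F"
    using F0 by (auto simp: F_def)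
  define P where "P = (\<lambda>(s, f). inv s \<otimes> f) ` (E \<times> F)"
  have P: "finite P" "P \<subseteq> carrier G"
    using E F by (auto simp: P_def)
  \<comment> \<open>\<open>P\<close> times \<open>Fs j\<close> times \<open>k\<close> contains the
    thickened support of a translate. If
    \<open>q \<otimes> f \<otimes> k = q' \<otimes> f' \<otimes> l\<close>, then \<open>inv q'
    \<otimes> q \<otimes> f = f' \<otimes> (l \<otimes> inv k)\<close>, so quotients of
    \<open>P\<close> detect overlaps.\<close>
  define F' where "F' = (\<lambda>(p, q). inv p \<otimes> q) ` (P \<times> P)"
  have "\<one> \<in> P"
    using E F by (force simp: P_def)
  then have F': "finite F'" "F' \<noteq> {}" "F' \<subseteq> carrier G"
    using P by (auto simp: F'_def)
  have "\<exists>z. (\<forall>j\<in>{1..m}. \<forall>s\<in>Fs j. dist (\<alpha> s (xs j)) (\<alpha> s z) \<le> \<epsilon>) \<and> (\<forall>s\<in>H. \<alpha> s z = z)"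
    if Fs: "\<forall>j\<in>{1..m}. finite (Fs j) \<and> Fs j \<subseteq> carrier G"
      and disj: "\<forall>i\<in>{1..m}. \<forall>j\<in>{1..m}. i \<noteq> j \<longrightarrow> (F' <#> Fs i) \<inter> Fs j = {}"
      and H: "subgroup H G"
      and disjH: "\<forall>i\<in>{1..m}. \<forall>j\<in>{1..m}. (F' <#> Fs i) \<inter> (Fs j <#> (H - {\<one>})) = {}"
    for m :: nat and Fs H xs
  proof -
    have HG: "k \<in> carrier G" if "k \<in> H" for k
      using subgroup.mem_carrier[OF H that] .
    have "\<forall>j\<in>{1..m}. \<exists>y. (\<forall>s\<in>Fs j. dist (\<alpha> s (xs j)) (\<alpha> s y) \<le> \<delta>) \<and>
        (\<forall>s\<in>carrier G - (F0 <#> Fs j). dist 0 (\<alpha> s y) \<le> \<delta>)"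
    proof
      fix j assume "j \<in> {1..m}"
      with Fs have "finite (Fs j)" "Fs j \<subseteq> carrier G" by auto
      from spec[OF this, of "xs j"] show "\<exists>y. (\<forall>s\<in>Fs j. dist (\<alpha> s (xs j)) (\<alpha> s y) \<le> \<delta>) \<and>
        (\<forall>s\<in>carrier G - (F0 <#> Fs j). dist 0 (\<alpha> s y) \<le> \<delta>)"
        by auto
    qed
    from bchoice[OF this] obtain y where y:
      "\<And>j s. j \<in> {1..m} \<Longrightarrow> s \<in> Fs j \<Longrightarrow> dist (\<alpha> s (xs j)) (\<alpha> s (y j)) \<le> \<delta>"
      "\<And>j s. j \<in> {1..m} \<Longrightarrow> s \<in> carrier G - (F0 <#> Fs j) \<Longrightarrow> dist 0 (\<alpha> s (y j)) \<le> \<delta>"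
      by blast
    define I where "I = {1..m} \<times> H"
    \<comment> \<open>Since \<open>\<alpha> t (w (j, k))\<close> is
      \<open>\<alpha> (t \<otimes> inv k) (y j)\<close>, the translate can be large only where
      \<open>t \<otimes> inv k\<close> lies in the support of \<open>y j\<close>.\<close>
    define w where "w = (\<lambda>(j, k). \<alpha> (inv k) (y j))"
    define A where "A = (\<lambda>(j, k). {t. t \<otimes> inv k \<in> F <#> Fs j})"
    have finA: "finite (F <#> Fs j)" and AG: "F <#> Fs j \<subseteq> carrier G" if "j \<in> {1..m}" for j
      using F Fs that set_mult_closed[of F "Fs j"] by (auto simp: set_mult_def)
    have small: "dist 0 (\<alpha> t (w p)) \<le> \<delta>" if mem: "p \<in> I" "t \<in> carrier G" "t \<notin> A p" for p t
    proof -
      obtain j k where p: "p = (j, k)" "j \<in> {1..m}" "k \<in> H"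
        using mem(1) by (auto simp: I_def)
      have "t \<otimes> inv k \<in> carrier G - (F0 <#> Fs j)"
        using mem(2,3) p HG[of k] by (auto simp: A_def F_def set_mult_def)
      then show ?thesis
        using y(2)[OF p(2)] p mem(2) HG[of k] by (simp add: w_def act_mult[symmetric])
    qed
    have thick: "\<exists>q\<in>P. \<exists>f\<in>Fs j. t = q \<otimes> f \<otimes> k"
      if mem: "j \<in> {1..m}" "k \<in> H" "t \<in> carrier G" "s \<in> E" "s \<otimes> t \<in> A (j, k)" for j k t s
    proof -
      obtain f g where fg: "f \<in> F" "g \<in> Fs j" "s \<otimes> t \<otimes> inv k = f \<otimes> g"
        using mem(5) by (auto simp: A_def set_mult_def)
      have G: "f \<in> carrier G" "g \<in> carrier G" "k \<in> carrier G" "s \<in> carrier G"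
        using fg F Fs mem HG E by auto
      have "inv s \<otimes> f \<otimes> g \<otimes> k = inv s \<otimes> (s \<otimes> t \<otimes> inv k) \<otimes> k"
        using G by (simp add: fg(3) m_assoc)
      also have "\<dots> = t"
        using G mem(3) by (simp add: m_assoc[symmetric]) (simp add: m_assoc)
      finally show ?thesis
        using fg \<open>s \<in> E\<close> by (force simp: P_def)
    qed
    have separated: "p = p'"
      if mem: "p \<in> I" "p' \<in> I" "t \<in> carrier G" "s \<in> E" "s' \<in> E" "s \<otimes> t \<in> A p" "s' \<otimes> t \<in> A p'"
      for p p' t s s'
    proof -
      obtain i k where p: "p = (i, k)" "i \<in> {1..m}" "k \<in> H"
        using mem(1) by (auto simp: I_def)
      obtain j l where p': "p' = (j, l)" "j \<in> {1..m}" "l \<in> H"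
        using mem(2) by (auto simp: I_def)
      obtain q f where q: "q \<in> P" "f \<in> Fs i" "t = q \<otimes> f \<otimes> k"
        using thick[of i k t s] mem p by auto
      obtain q' f' where q': "q' \<in> P" "f' \<in> Fs j" "t = q' \<otimes> f' \<otimes> l"
        using thick[of j l t s'] mem p' by auto
      have G: "q \<in> carrier G" "q' \<in> carrier G" "f \<in> carrier G" "f' \<in> carrier G"
        "k \<in> carrier G" "l \<in> carrier G"
        using q q' p p' P Fs HG by auto
      have "inv q' \<otimes> q \<otimes> f = inv q' \<otimes> (q \<otimes> f \<otimes> k) \<otimes> inv k"
        using G by (simp add: m_assoc)
      also have "\<dots> = inv q' \<otimes> (q' \<otimes> f' \<otimes> l) \<otimes> inv k"
        using q(3) q'(3) by simp
      also have "\<dots> = f' \<otimes> (l \<otimes> inv k)"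
        using G by (simp add: m_assoc[symmetric])
      finally have eq: "inv q' \<otimes> q \<otimes> f = f' \<otimes> (l \<otimes> inv k)" .
      have mem_l: "inv q' \<otimes> q \<otimes> f \<in> F' <#> Fs i"
        using q q' by (force simp: F'_def set_mult_def)
      have "l \<otimes> inv k \<in> H"
        using H p p' by (simp add: subgroup.m_closed subgroup.m_inv_closed)
      \<comment> \<open>The condition on \<open>H\<close> also covers \<open>i = j\<close>, so it
        first forces equal translates; the condition between distinct sets then forces
        \<open>i = j\<close>.\<close>
      have "l \<otimes> inv k = \<one>"
      proof (rule ccontr)
        assume "l \<otimes> inv k \<noteq> \<one>"
        with \<open>l \<otimes> inv k \<in> H\<close> have "f' \<otimes> (l \<otimes> inv k) \<in> Fs j <#> (H - {\<one>})"
          using q'(2) by (auto simp: set_mult_def)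
        with eq mem_l disjH p(2) p'(2) show False by (metis IntI empty_iff)
      qed
      then have "l = k"
        using G by (metis inv_equality inv_inv inv_closed)
      moreover have "i = j"
      proof (rule ccontr)
        assume "i \<noteq> j"
        with disj p(2) p'(2) have "(F' <#> Fs i) \<inter> Fs j = {}" by blast
        moreover have "inv q' \<otimes> q \<otimes> f \<in> Fs j"
          using eq \<open>l \<otimes> inv k = \<one>\<close> q'(2) G by simp
        ultimately show False using mem_l by blast
      qed
      ultimately show ?thesis using p p' by simp
    qed
    have sum_small: "dist 0 (\<alpha> t (\<Sum>p\<in>J. w p)) \<le> \<delta>"
      if "finite J" "J \<subseteq> I" "t \<in> carrier G" "\<And>p s. p \<in> J \<Longrightarrow> s \<in> E \<Longrightarrow> s \<otimes> t \<notin> A p" for J t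
    proof (rule sum_small_off_supports[OF E(2,3) _ add that(1)])
      show "dist 0 x \<le> \<delta>" if "\<And>s. s \<in> E \<Longrightarrow> dist 0 (\<alpha> s x) \<le> c" for x
        using loc[OF that] by simp
      show "dist 0 (\<alpha> t (w p)) \<le> \<delta>" if "p \<in> J" "t \<in> carrier G" "t \<notin> A p" for p t
        using small that \<open>J \<subseteq> I\<close> by blast
      show "p = p'"
        if "p \<in> J" "p' \<in> J" "t \<in> carrier G" "s \<in> E" "s' \<in> E" "s \<otimes> t \<in> A p" "s' \<otimes> t \<in> A p'"
        for p p' t s s'
        using separated that \<open>J \<subseteq> I\<close> by blast
    qed (use that in auto)
    \<comment> \<open>These are the translates that matter near \<open>t\<close>. Finiteness comes
      from solving for \<open>k\<close> in terms of \<open>s \<otimes> t\<close> and an element of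
      some \<open>F <#> Fs j\<close>.\<close>
    define B where "B t = {k \<in> H. \<exists>j\<in>{1..m}. \<exists>s\<in>E. s \<otimes> t \<in> A (j, k)}" for t
    have finB: "finite (B t)" if t: "t \<in> carrier G" for t
    proof (rule finite_subset)
      show "B t \<subseteq> (\<lambda>(a, s). inv a \<otimes> (s \<otimes> t)) ` ((\<Union>j\<in>{1..m}. F <#> Fs j) \<times> E)"
      proof
        fix k assume "k \<in> B t"
        then obtain j s where k: "k \<in> H" "j \<in> {1..m}" "s \<in> E" "s \<otimes> t \<otimes> inv k \<in> F <#> Fs j"
          by (auto simp: B_def A_def)
        have G: "s \<otimes> t \<in> carrier G" "k \<in> carrier G"
          using k E HG t by auto
        have "k = k \<otimes> (inv (s \<otimes> t) \<otimes> (s \<otimes> t))"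
          using G by simp
        also have "\<dots> = inv (s \<otimes> t \<otimes> inv k) \<otimes> (s \<otimes> t)"
          using G by (simp only: inv_mult_group[of "s \<otimes> t" "inv k"] inv_inv inv_closed m_assoc)
        finally have "k = inv (s \<otimes> t \<otimes> inv k) \<otimes> (s \<otimes> t)" .
        then show "k \<in> (\<lambda>(a, s). inv a \<otimes> (s \<otimes> t)) ` ((\<Union>j\<in>{1..m}. F <#> Fs j) \<times> E)"
          using k by force
      qed
      show "finite ((\<lambda>(a, s). inv a \<otimes> (s \<otimes> t)) ` ((\<Union>j\<in>{1..m}. F <#> Fs j) \<times> E))"
        using finA E by auto
    qed
    \<comment> \<open>Invariance is relaxed to a closed condition that finite sums can meet; over
      all \<open>t\<close>, expansiveness restores equality.\<close>
    define C where "C = (\<lambda>(t, h). {z. (\<forall>j\<in>{1..m}. t \<in> Fs j \<longrightarrow> dist (\<alpha> t (xs j)) (\<alpha> t z) \<le> \<epsilon>) \<and>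
      dist 0 (\<alpha> t (\<alpha> h z - z)) \<le> c})"
    have "UNIV \<inter> (\<Inter>q\<in>carrier G \<times> H. C q) \<noteq> {}"
    proof (rule compact_imp_fip_image[OF compact_space])
      show "closed (C q)" if "q \<in> carrier G \<times> H" for q
      proof -
        obtain t h where q: "q = (t, h)" "t \<in> carrier G" "h \<in> carrier G"
          using \<open>q \<in> carrier G \<times> H\<close> HG by auto
        show ?thesis
          unfolding C_def q(1) prod.case Ball_def using q(2,3)
          by (intro closed_Collect_conj closed_Collect_all closed_Collect_imp closed_Collect_le
            open_Collect_const continuous_intros) auto
      qed
    next
      fix Q assume Q: "finite Q" "Q \<subseteq> carrier G \<times> H"
      \<comment> \<open>\<open>B t\<close> and its shift by \<open>h\<close> ensure that no
        translate relevant at \<open>t\<close> lies in \<open>L\<close> but not in its shift by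
        \<open>inv h\<close>, or conversely; \<open>\<one>\<close> supplies the summands
        \<open>y j\<close> themselves.\<close>
      define L where "L = insert \<one> (\<Union>(t, h)\<in>Q. B t \<union> (\<lambda>k. k \<otimes> h) ` B t)"
      have BH: "B t \<subseteq> H" for t
        by (auto simp: B_def)
      have L: "finite L" "L \<subseteq> H" "\<one> \<in> L"
        using Q finB BH H by (auto simp: L_def subgroup.one_closed subgroup.m_closed subset_iff)
      define z where "z = (\<Sum>p\<in>{1..m} \<times> L. w p)"
      have "z \<in> C (t, h)" if th: "(t, h) \<in> Q" for t h
      proof -
        have t: "t \<in> carrier G" and h: "h \<in> H" "h \<in> carrier G"
          using th Q HG by auto
        have "dist (\<alpha> t (xs j)) (\<alpha> t z) \<le> \<epsilon>" if j: "j \<in> {1..m}" "t \<in> Fs j" for j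
        proof -
          \<comment> \<open>As \<open>t\<close> lies in the support of \<open>(j, \<one>)\<close>,
            separation keeps it out of every other thickened support.\<close>
          let ?J = "{1..m} \<times> L - {(j, \<one>)}"
          have tA: "\<one> \<otimes> t \<in> A (j, \<one>)"
            using j t F by (force simp: A_def set_mult_def)
          have "dist 0 (\<alpha> t (\<Sum>p\<in>?J. w p)) \<le> \<delta>"
          proof (rule sum_small)
            show "s \<otimes> t \<notin> A p" if "p \<in> ?J" "s \<in> E" for p s
            proof
              assume "s \<otimes> t \<in> A p"
              then have "p = (j, \<one>)"
                using that L E t j(1) tA H
                by (intro separated[of p _ t s \<one>]) (auto simp: I_def subgroup.one_closed)
              with that show False by simp
            qed
          qed (use L t in \<open>auto simp: I_def\<close>)
          moreover have "z = y j + (\<Sum>p\<in>?J. w p)"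
            unfolding z_def using L j(1)
            by (subst sum.remove[of _ "(j, \<one>)"]) (auto simp: w_def act_one)
          ultimately have "dist (\<alpha> t (y j)) (\<alpha> t z) \<le> \<eta>"
            using d_add \<delta>(2) t by (simp add: act_add)
          then show ?thesis
            using y(1)[OF j] \<delta> \<eta> dist_triangle[of "\<alpha> t (xs j)" "\<alpha> t z" "\<alpha> t (y j)"] by linarith
        qed
        moreover have "dist 0 (\<alpha> t (\<alpha> h z - z)) \<le> c"
        proof -
          \<comment> \<open>Applying \<open>h\<close> to \<open>w (j, k)\<close> gives
            \<open>w (j, k \<otimes> inv h)\<close>, so \<open>\<alpha> h z\<close> is the same sum
            over shifted indices and the common terms cancel in
            \<open>\<alpha> h z - z\<close>.\<close>
          let ?L' = "(\<lambda>k. k \<otimes> inv h) ` L"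
          let ?P = "{1..m} \<times> ?L'" and ?Q = "{1..m} \<times> L"
          have L': "finite ?L'" "?L' \<subseteq> H"
            using L h H by (auto simp: subgroup.m_closed subgroup.m_inv_closed subset_iff)
          have inj: "inj_on (\<lambda>k. k \<otimes> inv h) L"
            using L HG h by (auto intro!: inj_onI simp: subset_iff)
          have "\<alpha> h z = (\<Sum>p\<in>?Q. \<alpha> h (w p))"
            using h by (simp add: z_def act_sum)
          also have "\<dots> = (\<Sum>(j, k)\<in>?Q. w (j, k \<otimes> inv h))"
            using L HG h
            by (intro sum.cong) (auto simp: w_def act_mult[symmetric] inv_mult_group subset_iff)
          also have "\<dots> = (\<Sum>p\<in>?P. w p)"
            using inj by (simp add: sum.cartesian_product' sum.reindex)
          finally have "\<alpha> h z - z = (\<Sum>p\<in>?P. w p) - (\<Sum>p\<in>?Q. w p)"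
            by (simp add: z_def)
          also have "\<dots> = (\<Sum>p\<in>?P - ?Q. w p) - (\<Sum>p\<in>?Q - ?P. w p)"
            using L L' by (intro sum_diff_sum) auto
          finally have eq: "\<alpha> h z - z = (\<Sum>p\<in>?P - ?Q. w p) - (\<Sum>p\<in>?Q - ?P. w p)" .
          have "dist 0 (\<alpha> t (\<Sum>p\<in>?P - ?Q. w p)) \<le> \<delta>"
          proof (rule sum_small)
            show "s \<otimes> t \<notin> A p" if "p \<in> ?P - ?Q" "s \<in> E" for p s
            proof
              assume "s \<otimes> t \<in> A p"
              with that L' have "snd p \<in> B t"
                by (auto simp: B_def subset_iff)
              then have "snd p \<in> L" using th by (auto simp: L_def)
              with that show False by auto
            qed
          qed (use L L' t in \<open>auto simp: I_def subset_iff\<close>)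
          \<comment> \<open>An index \<open>k\<close> in \<open>B t\<close> would give
            \<open>k \<otimes> h \<in> L\<close>, hence \<open>k \<in> ?L'\<close>.\<close>
          moreover have "dist 0 (\<alpha> t (\<Sum>p\<in>?Q - ?P. w p)) \<le> \<delta>"
          proof (rule sum_small)
            show "s \<otimes> t \<notin> A p" if "p \<in> ?Q - ?P" "s \<in> E" for p s
            proof
              assume "s \<otimes> t \<in> A p"
              with that L have mem: "snd p \<in> B t"
                by (auto simp: B_def subset_iff)
              then have "snd p \<otimes> h \<in> L" using th by (force simp: L_def)
              moreover have "snd p = snd p \<otimes> h \<otimes> inv h"
                using mem BH HG h by (simp add: m_assoc subset_iff)
              ultimately have "snd p \<in> ?L'" by (rule rev_image_eqI)
              with that show False by auto
            qed
          qed (use L L' t in \<open>auto simp: I_def subset_iff\<close>)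
          ultimately show ?thesis
            unfolding eq using diff t by (simp add: act_diff)
        qed
        ultimately show ?thesis by (simp add: C_def)
      qed
      then have "z \<in> (\<Inter>q\<in>Q. C q)" by force
      then show "UNIV \<inter> (\<Inter>q\<in>Q. C q) \<noteq> {}" by blast
    qed
    then obtain z where "z \<in> (\<Inter>q\<in>carrier G \<times> H. C q)" by blast
    then have z: "z \<in> C (t, h)" if "t \<in> carrier G" "h \<in> H" for t h
      using that by blast
    have "dist (\<alpha> s (xs j)) (\<alpha> s z) \<le> \<epsilon>" if "j \<in> {1..m}" "s \<in> Fs j" for j s
      using z[of s \<one>] that Fs H by (auto simp: C_def subgroup.one_closed subset_iff)
    \<comment> \<open>The whole orbit of \<open>\<alpha> h z - z\<close> is within \<open>c\<close>
      of \<open>0\<close>, so the difference vanishes.\<close>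
    moreover have "\<alpha> h z = z" if "h \<in> H" for h
      using eq_zero_if_orbit_small[of "\<alpha> h z - z"] z[OF _ that] by (auto simp: C_def)
    ultimately show ?thesis by blast
  qed
  with F' show "\<exists>F. finite F \<and> F \<noteq> {} \<and> F \<subseteq> carrier G \<and>
      (\<forall>(m::nat) Fs H xs.
        (\<forall>j\<in>{1..m}. finite (Fs j) \<and> Fs j \<subseteq> carrier G) \<longrightarrow>
        (\<forall>i\<in>{1..m}. \<forall>j\<in>{1..m}. i \<noteq> j \<longrightarrow> (F <#> Fs i) \<inter> Fs j = {}) \<longrightarrow>
        subgroup H G \<longrightarrow>
        (\<forall>i\<in>{1..m}. \<forall>j\<in>{1..m}. (F <#> Fs i) \<inter> (Fs j <#> (H - {\<one>})) = {}) \<longrightarrow>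
        (\<exists>y. (\<forall>j\<in>{1..m}. \<forall>s\<in>Fs j. dist (\<alpha> s (xs j)) (\<alpha> s y) \<le> \<epsilon>) \<and> (\<forall>s\<in>H. \<alpha> s y = y)))"
    by (intro exI[of _ F']) blast
qed

end

section \<open>The cycle of implications\<close>

theorem theorem6p3:
  fixes G :: "('g, 'b) monoid_scheme"
    and \<alpha> :: "'g \<Rightarrow> 'x :: {topological_ab_group_add, metric_space} \<Rightarrow> 'x"
  assumes "group G"
    and "countable (carrier G)"
    and "compact (UNIV :: 'x set)"
    and "acts_by_automorphisms G \<alpha>"
    and "expansive G \<alpha>"
  shows "(weak_specification G \<alpha> \<longleftrightarrow> strong_specification G \<alpha>) \<and>
         (strong_specification G \<alpha> \<longleftrightarrow> homoclinic_specification G \<alpha>) \<and>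
         (weak_specification G \<alpha> \<longrightarrow> closure (homoclinic_points G \<alpha>) = UNIV)"
proof -
  obtain c where c: "c > 0"
    "\<And>x y. x \<noteq> y \<Longrightarrow> (SUP s\<in>carrier G. dist (\<alpha> s x) (\<alpha> s y)) > c"
    using assms(5) unfolding expansive_def by blast
  have zero: "\<alpha> s 0 = 0" if "s \<in> carrier G" for s
    using assms(4) that unfolding acts_by_automorphisms_def by (metis add_cancel_left_left add_0)
  \<comment> \<open>Boundedness of the metric makes the supremum genuine, so exceeding
    \<open>c\<close> yields an actual \<open>s\<close>.\<close>
  obtain b where b: "\<And>x y :: 'x. dist x y \<le> b"
    using compact_imp_bounded[OF assms(3)] by (auto simp: bounded_two_points)
  interpret expansive_algebraic_action G \<alpha> c
  proof (intro expansive_algebraic_action.intro expansive_algebraic_action_axioms.intro)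
    show "\<exists>s\<in>carrier G. dist 0 (\<alpha> s x) > c" if "x \<noteq> 0" for x
    proof -
      have "carrier G \<noteq> {}"
        using group.is_monoid[OF assms(1)] monoid.one_closed by blast
      moreover have "bdd_above ((\<lambda>s. dist (\<alpha> s 0) (\<alpha> s x)) ` carrier G)"
        using b by (intro bdd_aboveI2)
      ultimately have "\<exists>s\<in>carrier G. dist (\<alpha> s 0) (\<alpha> s x) > c"
        using c(2)[of 0 x] that by (simp add: less_cSUP_iff)
      with zero show ?thesis by auto
    qed
  qed (use assms c in auto)
  show ?thesis
    using strong_imp_weak_specification[OF assms(1)] weak_imp_homoclinic_specification
      homoclinic_imp_strong_specification homoclinic_specification_imp_dense by blast
qed

end
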